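(* Let $\beta\in B_{36}$ be the braid $$\beta=(\beta_1^{36},\ \beta_2^{18},\ \beta_1^{36},\ \beta_3^{30},\ \beta_3^{30},\ \beta_3^{30},\ \beta_1^{36},\ \beta_2^{18},\ \beta_1^{36}),$$ the horizontal juxtaposition, from left to right, of the indicated powers of the braids $$\beta_1=\sigma_1\sigma_2^{-1}\in B_3,\qquad \beta_2=\sigma_1^{-3}\sigma_3^{-2}\sigma_5^{-3}\sigma_2\sigma_4\in B_6,\qquad \beta_3=\sigma_2^{-2}\sigma_1\sigma_3^{-1}\in B_4.$$ Then $\beta$ is a pure braid; that is, the permutation $P(\beta)\in S_{36}$ associated to $\beta$ is the identity.
   Context: For $n\ge 1$, $B_n$ denotes the braid group on $n$ strands, with generators $\sigma_1,\dots,\sigma_{n-1}$ and defining relations $\sigma_i\sigma_{i+1}\sigma_i=\sigma_{i+1}\sigma_i\sigma_{i+1}$ for $1\le i\le n-2$, and $\sigma_i\sigma_j=\sigma_j\sigma_i$ whenever $|i-j|>1$. $S_n$ is the symmetric group on $\{1,\dots,n\}$, with products read from left to right, and $P\colon B_n\to S_n$ is the group homomorphism sending $\sigma_i$ to the transposition $\tau_i$ interchanging $i$ and $i+1$. A braid in $B_n$ is called pure if its image under $P$ is the identity of $S_n$. Juxtaposition: given braids $b_1\in B_{n_1},\dots,b_r\in B_{n_r}$, the braid $(b_1,\dots,b_r)\in B_{n_1+\cdots+n_r}$ is obtained by placing $b_1,\dots,b_r$ next to each other from left to right. Algebraically, with $m_k=n_1+\cdots+n_{k-1}$ (so $m_1=0$),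 it is the product $\iota_1(b_1)\cdots\iota_r(b_r)$, where $\iota_k\colon B_{n_k}\to B_{n_1+\cdots+n_r}$ is the homomorphism $\sigma_i\mapsto\sigma_{m_k+i}$. Here $36=3+6+3+4+4+4+3+6+3$. *)

theory Defs
  imports "HOL-Algebra.Sym_Groups"
begin

section \<open>The braid group by generators and relations\<close>

text \<open>The letter \<open>(i, True)\<close> stands for \<open>\<sigma>\<^sub>i\<close> and \<open>(i, False)\<close> for its formal inverse.
  The relation \<open>braid_eq n\<close> is the congruence on words in the letters with \<open>1 \<le> i < n\<close>
  generated by free cancellation and the two families of braid relations.\<close>

type_synonym braid_word = "(nat \<times> bool) list"

definition braid_words :: "nat \<Rightarrow> braid_word set" where
  "braid_words n = lists ({1..<n} \<times> UNIV)"

inductive braid_eq :: "nat \<Rightarrow> braid_word \<Rightarrow> braid_word \<Rightarrow> bool" for n :: nat where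
  refl: "w \<in> braid_words n \<Longrightarrow> braid_eq n w w"
| sym: "braid_eq n u v \<Longrightarrow> braid_eq n v u"
| trans: "braid_eq n u v \<Longrightarrow> braid_eq n v w \<Longrightarrow> braid_eq n u w"
| append: "braid_eq n u u' \<Longrightarrow> braid_eq n v v' \<Longrightarrow> braid_eq n (u @ v) (u' @ v')"
| cancel: "i \<in> {1..<n} \<Longrightarrow> braid_eq n [(i, e), (i, \<not> e)] []"
| braid: "1 \<le> i \<Longrightarrow> i + 1 < n \<Longrightarrow>
    braid_eq n [(i, True), (i + 1, True), (i, True)] [(i + 1, True), (i, True), (i + 1, True)]"
| commute: "i \<in> {1..<n} \<Longrightarrow> j \<in> {1..<n} \<Longrightarrow> \<bar>int i - int j\<bar> > 1 \<Longrightarrow>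
    braid_eq n [(i, True), (j, True)] [(j, True), (i, True)]"

definition braid_rel :: "nat \<Rightarrow> (braid_word \<times> braid_word) set" where
  "braid_rel n = {(u, v). braid_eq n u v}"

definition braid_class :: "nat \<Rightarrow> braid_word \<Rightarrow> braid_word set" where
  "braid_class n w = braid_rel n `` {w}"

definition braid_group :: "nat \<Rightarrow> braid_word set monoid" where
  "braid_group n =
    \<lparr>carrier = braid_words n // braid_rel n,
     mult = (\<lambda>a b. \<Union>u\<in>a. \<Union>v\<in>b. braid_class n (u @ v)),
     one = braid_class n []\<rparr>"

definition braid_gen :: "nat \<Rightarrow> nat \<Rightarrow> braid_word set" where
  "braid_gen n i = braid_class n [(i, True)]"

lemma braid_eq_words: "braid_eq n u v \<Longrightarrow> u \<in> braid_words n \<and> v \<in> braid_words n"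
  by (induction rule: braid_eq.induct) (auto simp: braid_words_def)

lemma equiv_braid_rel: "equiv (braid_words n) (braid_rel n)"
proof (rule equivI)
  show "braid_rel n \<subseteq> braid_words n \<times> braid_words n"
    by (auto simp: braid_rel_def dest: braid_eq_words)
  show "refl_on (braid_words n) (braid_rel n)"
    by (auto simp: braid_rel_def refl_on_def intro: braid_eq.refl)
  show "sym (braid_rel n)"
    by (auto simp: braid_rel_def intro!: symI dest: braid_eq.sym)
  show "trans (braid_rel n)"
    unfolding braid_rel_def by (rule transI) (blast intro: braid_eq.trans)
qed

lemma braid_class_eq_iff:
  assumes "u \<in> braid_words n" "v \<in> braid_words n"
  shows "braid_class n u = braid_class n v \<longleftrightarrow> braid_eq n u v"
  using eq_equiv_class_iff[OF equiv_braid_rel assms]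
  by (simp add: braid_class_def braid_rel_def)

lemma mem_braid_class: "v \<in> braid_class n u \<longleftrightarrow> braid_eq n u v"
  by (simp add: braid_class_def braid_rel_def)

lemma carrier_braid_group: "carrier (braid_group n) = braid_class n ` braid_words n"
  by (auto simp: braid_group_def quotient_def braid_class_def)

lemma one_braid_group: "\<one>\<^bsub>braid_group n\<^esub> = braid_class n []"
  by (simp add: braid_group_def)

lemma braid_words_append [simp]:
  "u @ v \<in> braid_words n \<longleftrightarrow> u \<in> braid_words n \<and> v \<in> braid_words n"
  by (auto simp: braid_words_def)

lemma braid_words_Nil [simp]: "[] \<in> braid_words n"
  by (simp add: braid_words_def)

lemma mult_braid_group:
  assumes "u \<in> braid_words n" "v \<in> braid_words n"
  shows "braid_class n u \<otimes>\<^bsub>braid_group n\<^esub> braid_class n v = braid_class n (u @ v)"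
proof -
  have "braid_class n (u' @ v') = braid_class n (u @ v)"
    if "u' \<in> braid_class n u" "v' \<in> braid_class n v" for u' v'
  proof -
    have "braid_eq n (u @ v) (u' @ v')"
      using that by (simp add: mem_braid_class braid_eq.append)
    then show ?thesis
      using braid_eq_words[of n "u @ v" "u' @ v'"] by (metis braid_class_eq_iff)
  qed
  moreover have "u \<in> braid_class n u" "v \<in> braid_class n v"
    using assms by (auto simp: mem_braid_class intro: braid_eq.refl)
  ultimately have "(\<Union>u'\<in>braid_class n u. \<Union>v'\<in>braid_class n v. braid_class n (u' @ v')) =
      braid_class n (u @ v)"
    by blast
  then show ?thesis
    by (simp add: braid_group_def)
qed

lemma braid_inverse_word:
  assumes "w \<in> braid_words n"
  shows "\<exists>v \<in> braid_words n. braid_eq n (v @ w) []"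
  using assms
proof (induction w)
  case Nil
  then show ?case by (auto intro!: bexI[of _ "[]"] braid_eq.refl)
next
  case (Cons x w)
  obtain i e where x: "x = (i, e)" by (cases x)
  have i: "i \<in> {1..<n}" and w: "w \<in> braid_words n"
    using Cons.prems by (auto simp: x braid_words_def)
  obtain v where v: "v \<in> braid_words n" "braid_eq n (v @ w) []"
    using Cons.IH w by blast
  have "braid_eq n [(i, \<not> e), (i, e)] []"
    using braid_eq.cancel[OF i, of "\<not> e"] by simp
  then have "braid_eq n ([(i, \<not> e), (i, e)] @ w) ([] @ w)"
    using w by (intro braid_eq.append braid_eq.refl)
  then have "braid_eq n (v @ [(i, \<not> e), (i, e)] @ w) (v @ [] @ w)"
    using v by (intro braid_eq.append[of n v v] braid_eq.refl)
  then have "braid_eq n ((v @ [(i, \<not> e)]) @ x # w) []"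
    using v(2) by (auto simp: x intro: braid_eq.trans)
  moreover have "v @ [(i, \<not> e)] \<in> braid_words n"
    using v i by (auto simp: braid_words_def)
  ultimately show ?case by blast
qed

lemma group_braid_group: "group (braid_group n)"
proof (rule groupI)
  fix x assume "x \<in> carrier (braid_group n)"
  then obtain w where w: "w \<in> braid_words n" "x = braid_class n w"
    by (auto simp: carrier_braid_group)
  obtain v where "v \<in> braid_words n" "braid_eq n (v @ w) []"
    using braid_inverse_word[OF w(1)] by blast
  then show "\<exists>y\<in>carrier (braid_group n). y \<otimes>\<^bsub>braid_group n\<^esub> x = \<one>\<^bsub>braid_group n\<^esub>"
    using w by (auto simp: carrier_braid_group mult_braid_group one_braid_group
        braid_class_eq_iff intro!: bexI[of _ v])
qed (auto simp: carrier_braid_group mult_braid_group one_braid_group)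

lemma braid_gen_closed: "i \<in> {1..<n} \<Longrightarrow> braid_gen n i \<in> carrier (braid_group n)"
  by (auto simp: braid_gen_def carrier_braid_group braid_words_def)


section \<open>Homomorphisms out of the braid group\<close>

text \<open>For \<open>f\<close> respecting the braid relations, \<open>braid_lift G f\<close> is the homomorphism sending
  the \<open>i\<close>-th generator to \<open>f i\<close>; by \<open>braid_eq_eval\<close> below all words in a class then have
  the same value, so that \<open>the_elem\<close> is applied to a singleton.\<close>

definition word_eval :: "('a, 'b) monoid_scheme \<Rightarrow> (nat \<Rightarrow> 'a) \<Rightarrow> braid_word \<Rightarrow> 'a" where
  "word_eval G f w =
    foldr (\<lambda>(i, e) x. (if e then f i else inv\<^bsub>G\<^esub> (f i)) \<otimes>\<^bsub>G\<^esub> x) w \<one>\<^bsub>G\<^esub>"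

definition braid_lift :: "('a, 'b) monoid_scheme \<Rightarrow> (nat \<Rightarrow> 'a) \<Rightarrow> braid_word set \<Rightarrow> 'a" where
  "braid_lift G f b = the_elem (word_eval G f ` b)"

definition respects_braid_relations ::
    "nat \<Rightarrow> ('a, 'b) monoid_scheme \<Rightarrow> (nat \<Rightarrow> 'a) \<Rightarrow> bool" where
  "respects_braid_relations n G f \<longleftrightarrow>
    f ` {1..<n} \<subseteq> carrier G \<and>
    (\<forall>i. 1 \<le> i \<and> i + 1 < n \<longrightarrow>
      f i \<otimes>\<^bsub>G\<^esub> f (i + 1) \<otimes>\<^bsub>G\<^esub> f i = f (i + 1) \<otimes>\<^bsub>G\<^esub> f i \<otimes>\<^bsub>G\<^esub> f (i + 1)) \<and>
    (\<forall>i\<in>{1..<n}. \<forall>j\<in>{1..<n}. \<bar>int i - int j\<bar> > 1 \<longrightarrow> f i \<otimes>\<^bsub>G\<^esub> f j = f j \<otimes>\<^bsub>G\<^esub> f i)"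

context group
begin

lemma word_eval_closed:
  "f ` {1..<n} \<subseteq> carrier G \<Longrightarrow> w \<in> braid_words n \<Longrightarrow> word_eval G f w \<in> carrier G"
  by (induction w) (auto simp: word_eval_def braid_words_def image_subset_iff)

lemma word_eval_append:
  assumes "f ` {1..<n} \<subseteq> carrier G" "u \<in> braid_words n" "v \<in> braid_words n"
  shows "word_eval G f (u @ v) = word_eval G f u \<otimes> word_eval G f v"
  using assms(2)
proof (induction u)
  case Nil
  then show ?case using word_eval_closed[OF assms(1,3)] by (simp add: word_eval_def)
next
  case (Cons x u)
  obtain i e where x: "x = (i, e)" by (cases x)
  have "u \<in> braid_words n" "f i \<in> carrier G"
    using Cons.prems assms(1) by (auto simp: x braid_words_def image_subset_iff)
  with Cons.IH word_eval_closed[OF assms(1)] assms(3) show ?case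
    by (simp add: word_eval_def x m_assoc)
qed

lemma braid_eq_eval:
  assumes f: "respects_braid_relations n G f" and "braid_eq n u v"
  shows "word_eval G f u = word_eval G f v"
  using assms(2)
proof (induction rule: braid_eq.induct)
  case (append u u' v v')
  then show ?case
    using f braid_eq_words[OF append.hyps(1)] braid_eq_words[OF append.hyps(2)]
    by (simp add: word_eval_append[where n = n] respects_braid_relations_def)
next
  case (cancel i e)
  then have "f i \<in> carrier G"
    using f by (auto simp: respects_braid_relations_def)
  then show ?case by (simp add: word_eval_def)
next
  case (braid i)
  then have "f i \<in> carrier G" "f (i + 1) \<in> carrier G"
    "f i \<otimes> f (i + 1) \<otimes> f i = f (i + 1) \<otimes> f i \<otimes> f (i + 1)"
    using f by (auto simp: respects_braid_relations_def image_subset_iff)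
  then show ?case by (simp add: word_eval_def m_assoc)
next
  case (commute i j)
  then have "f i \<in> carrier G" "f j \<in> carrier G" "f i \<otimes> f j = f j \<otimes> f i"
    using f by (auto simp: respects_braid_relations_def image_subset_iff)
  then show ?case by (simp add: word_eval_def)
qed simp_all

lemma braid_lift_class:
  assumes "respects_braid_relations n G f" "w \<in> braid_words n"
  shows "braid_lift G f (braid_class n w) = word_eval G f w"
proof -
  have "word_eval G f ` braid_class n w = {word_eval G f w}"
  proof (rule equalityI)
    show "word_eval G f ` braid_class n w \<subseteq> {word_eval G f w}"
    proof (rule image_subsetI)
      fix v assume "v \<in> braid_class n w"
      then show "word_eval G f v \<in> {word_eval G f w}"
        using braid_eq_eval[OF assms(1), of w v] by (simp add: mem_braid_class)
    qed
    show "{word_eval G f w} \<subseteq> word_eval G f ` braid_class n w"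
      using braid_eq.refl[OF assms(2)] by (simp add: mem_braid_class)
  qed
  then show ?thesis by (simp add: braid_lift_def)
qed

lemma braid_lift_hom:
  assumes "respects_braid_relations n G f"
  shows "braid_lift G f \<in> hom (braid_group n) G"
proof -
  have "f ` {1..<n} \<subseteq> carrier G"
    using assms by (simp add: respects_braid_relations_def)
  then show ?thesis
    using assms
    by (auto simp: hom_def carrier_braid_group mult_braid_group braid_lift_class
        word_eval_append[where n = n] word_eval_closed[where n = n])
qed

lemma braid_lift_gen:
  assumes "respects_braid_relations n G f" "i \<in> {1..<n}"
  shows "braid_lift G f (braid_gen n i) = f i"
proof -
  have "[(i, True)] \<in> braid_words n" "f i \<in> carrier G"
    using assms by (auto simp: braid_words_def respects_braid_relations_def)
  then show ?thesis
    using assms by (simp add: braid_gen_def braid_lift_class word_eval_def)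
qed

end

lemma braid_gen_relations: "respects_braid_relations n (braid_group n) (braid_gen n)"
proof -
  have gen: "[(i, True)] \<in> braid_words n" if "i \<in> {1..<n}" for i
    using that by (simp add: braid_words_def)
  have words: "[(i, True), (j, True)] \<in> braid_words n"
    if "i \<in> {1..<n}" "j \<in> {1..<n}" for i j
    using that by (simp add: braid_words_def)
  have mult2: "braid_gen n i \<otimes>\<^bsub>braid_group n\<^esub> braid_gen n j =
      braid_class n [(i, True), (j, True)]" if "i \<in> {1..<n}" "j \<in> {1..<n}" for i j
    using mult_braid_group[OF gen[OF that(1)] gen[OF that(2)]] by (simp add: braid_gen_def)
  have mult3: "braid_gen n i \<otimes>\<^bsub>braid_group n\<^esub> braid_gen n j \<otimes>\<^bsub>braid_group n\<^esub> braid_gen n k =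
      braid_class n [(i, True), (j, True), (k, True)]"
    if "i \<in> {1..<n}" "j \<in> {1..<n}" "k \<in> {1..<n}" for i j k
    using mult_braid_group[OF words[OF that(1,2)] gen[OF that(3)]] mult2[OF that(1,2)]
    by (simp add: braid_gen_def)
  have "braid_gen n ` {1..<n} \<subseteq> carrier (braid_group n)"
    using braid_gen_closed by blast
  moreover have "braid_gen n i \<otimes>\<^bsub>braid_group n\<^esub> braid_gen n (i + 1) \<otimes>\<^bsub>braid_group n\<^esub> braid_gen n i =
      braid_gen n (i + 1) \<otimes>\<^bsub>braid_group n\<^esub> braid_gen n i \<otimes>\<^bsub>braid_group n\<^esub> braid_gen n (i + 1)"
    if "1 \<le> i" "i + 1 < n" for i
  proof -
    have "i \<in> {1..<n}" "i + 1 \<in> {1..<n}"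
      using that by auto
    moreover have "braid_class n [(i, True), (i + 1, True), (i, True)] =
        braid_class n [(i + 1, True), (i, True), (i + 1, True)]"
      using braid_eq.braid[OF that] braid_eq_words braid_class_eq_iff by metis
    ultimately show ?thesis
      by (simp only: mult3)
  qed
  moreover have "braid_gen n i \<otimes>\<^bsub>braid_group n\<^esub> braid_gen n j = braid_gen n j \<otimes>\<^bsub>braid_group n\<^esub> braid_gen n i"
    if "i \<in> {1..<n}" "j \<in> {1..<n}" "\<bar>int i - int j\<bar> > 1" for i j
  proof -
    have "braid_class n [(i, True), (j, True)] = braid_class n [(j, True), (i, True)]"
      using braid_eq.commute[OF that] braid_eq_words braid_class_eq_iff by metis
    then show ?thesis
      using that by (simp only: mult2)
  qed
  ultimately show ?thesis
    by (simp add: respects_braid_relations_def)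
qed


section \<open>The permutation of a braid\<close>

text \<open>Products are read from left to right, so the multiplication is opposite to that of
  \<^const>\<open>sym_group\<close>.\<close>

definition sym_group_lr :: "nat \<Rightarrow> (nat \<Rightarrow> nat) monoid" where
  "sym_group_lr n = \<lparr>carrier = {p. p permutes {1..n}}, mult = (\<lambda>p q. q \<circ> p), one = id\<rparr>"

definition braid_perm :: "nat \<Rightarrow> braid_word set \<Rightarrow> (nat \<Rightarrow> nat)" where
  "braid_perm n = braid_lift (sym_group_lr n) (\<lambda>i. transpose i (i + 1))"

definition pure_braid :: "nat \<Rightarrow> braid_word set \<Rightarrow> bool" where
  "pure_braid n b \<longleftrightarrow> b \<in> carrier (braid_group n) \<and> braid_perm n b = \<one>\<^bsub>sym_group_lr n\<^esub>"

lemma group_sym_group_lr: "group (sym_group_lr n)"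
proof (rule groupI)
  fix p assume "p \<in> carrier (sym_group_lr n)"
  then have p: "p permutes {1..n}"
    by (simp add: sym_group_lr_def)
  then show "\<exists>q\<in>carrier (sym_group_lr n). q \<otimes>\<^bsub>sym_group_lr n\<^esub> p = \<one>\<^bsub>sym_group_lr n\<^esub>"
    by (intro bexI[of _ "inv' p"])
      (simp_all add: sym_group_lr_def permutes_inv permutes_inv_o)
qed (simp_all add: sym_group_lr_def permutes_compose permutes_id comp_assoc)

lemma transpose_relations:
  "respects_braid_relations n (sym_group_lr n) (\<lambda>i. transpose i (i + 1))"
proof -
  have "transpose i (Suc i) permutes {1..n}" if "1 \<le> i" "i < n" for i
    using that by (intro permutes_swap_id) auto
  moreover have "transpose j (Suc j) \<circ> transpose i (Suc i) =
      transpose i (Suc i) \<circ> transpose j (Suc j)" if "\<bar>int i - int j\<bar> > 1" for i j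
    using that by (auto simp: fun_eq_iff transpose_def)
  moreover have "transpose i (Suc i) \<circ> (transpose (Suc i) (Suc (Suc i)) \<circ> transpose i (Suc i)) =
      transpose (Suc i) (Suc (Suc i)) \<circ> (transpose i (Suc i) \<circ> transpose (Suc i) (Suc (Suc i)))"
    for i
    by (auto simp: fun_eq_iff transpose_def)
  ultimately show ?thesis
    by (auto simp: respects_braid_relations_def sym_group_lr_def)
qed

lemmas braid_perm_hom = group.braid_lift_hom[OF group_sym_group_lr transpose_relations,
    folded braid_perm_def]

lemmas braid_perm_gen = group.braid_lift_gen[OF group_sym_group_lr transpose_relations,
    folded braid_perm_def]


section \<open>Juxtaposition\<close>

definition braid_embed :: "nat \<Rightarrow> nat \<Rightarrow> braid_word set \<Rightarrow> braid_word set" where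
  "braid_embed N m = braid_lift (braid_group N) (\<lambda>i. braid_gen N (m + i))"

lemma shifted_gen_relations:
  assumes "m + n \<le> N"
  shows "respects_braid_relations n (braid_group N) (\<lambda>i. braid_gen N (m + i))"
  using braid_gen_relations[of N] assms
  by (auto simp: respects_braid_relations_def image_subset_iff)

lemmas braid_embed_hom = group.braid_lift_hom[OF group_braid_group shifted_gen_relations,
    folded braid_embed_def]

lemmas braid_embed_gen = group.braid_lift_gen[OF group_braid_group shifted_gen_relations,
    folded braid_embed_def]

text \<open>Each entry \<open>(n, b)\<close> of the list is a braid \<open>b\<close> together with its number \<open>n\<close> of strands.\<close>

definition juxtapose :: "(nat \<times> braid_word set) list \<Rightarrow> braid_word set" where
  "juxtapose bs =
    (let N = sum_list (map fst bs);
         m = (\<lambda>k. sum_list (map fst (take k bs)))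
     in foldr (\<lambda>k x. braid_embed N (m k) (snd (bs ! k)) \<otimes>\<^bsub>braid_group N\<^esub> x)
          [0..<length bs] \<one>\<^bsub>braid_group N\<^esub>)"


section \<open>The braid\<close>

definition beta1 :: "braid_word set" where
  "beta1 = braid_gen 3 1 \<otimes>\<^bsub>braid_group 3\<^esub> inv\<^bsub>braid_group 3\<^esub> (braid_gen 3 2)"

definition beta2 :: "braid_word set" where
  "beta2 =
    braid_gen 6 1 [^]\<^bsub>braid_group 6\<^esub> (-3 :: int) \<otimes>\<^bsub>braid_group 6\<^esub>
    braid_gen 6 3 [^]\<^bsub>braid_group 6\<^esub> (-2 :: int) \<otimes>\<^bsub>braid_group 6\<^esub>
    braid_gen 6 5 [^]\<^bsub>braid_group 6\<^esub> (-3 :: int) \<otimes>\<^bsub>braid_group 6\<^esub>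
    braid_gen 6 2 \<otimes>\<^bsub>braid_group 6\<^esub> braid_gen 6 4"

definition beta3 :: "braid_word set" where
  "beta3 =
    braid_gen 4 2 [^]\<^bsub>braid_group 4\<^esub> (-2 :: int) \<otimes>\<^bsub>braid_group 4\<^esub>
    braid_gen 4 1 \<otimes>\<^bsub>braid_group 4\<^esub> inv\<^bsub>braid_group 4\<^esub> (braid_gen 4 3)"

definition beta :: "braid_word set" where
  "beta = juxtapose
    [(3, beta1 [^]\<^bsub>braid_group 3\<^esub> (36 :: nat)),
     (6, beta2 [^]\<^bsub>braid_group 6\<^esub> (18 :: nat)),
     (3, beta1 [^]\<^bsub>braid_group 3\<^esub> (36 :: nat)),
     (4, beta3 [^]\<^bsub>braid_group 4\<^esub> (30 :: nat)),
     (4, beta3 [^]\<^bsub>braid_group 4\<^esub> (30 :: nat)),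
     (4, beta3 [^]\<^bsub>braid_group 4\<^esub> (30 :: nat)),
     (3, beta1 [^]\<^bsub>braid_group 3\<^esub> (36 :: nat)),
     (6, beta2 [^]\<^bsub>braid_group 6\<^esub> (18 :: nat)),
     (3, beta1 [^]\<^bsub>braid_group 3\<^esub> (36 :: nat))]"

end

theory Submission
  imports Defs
begin

text \<open>A braid is pure iff it lies in the kernel of the homomorphism \<open>P\<close>. Pure braids are
  therefore closed under products, and they stay pure under juxtaposition because the embedding
  \<open>\<sigma>\<^sub>i \<mapsto> \<sigma>\<^bsub>m+i\<^esub>\<close> corresponds under \<open>P\<close> to transporting a permutation of
  \<open>{1..n}\<close> to \<open>{m+1..m+n}\<close> (\<open>braid_perm_braid_embed\<close>). This reduces the theorem to the nine
  blocks (\<open>pure_juxtapose\<close>).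

  Within a block only the order of the underlying permutation matters. A transposition is an
  involution, so in \<open>P\<close> signs of exponents disappear and exponents count modulo 2:
  \<open>\<beta>\<^sub>1\<close> maps to a 3-cycle; \<open>\<beta>\<^sub>2\<close> maps to \<open>\<tau>\<^sub>1\<tau>\<^sub>5\<tau>\<^sub>2\<tau>\<^sub>4\<close>, a product of
  two 3-cycles on \<open>{1,2,3}\<close> and \<open>{4,5,6}\<close>, since the even power of \<open>\<sigma>\<^sub>3\<close> drops out; and
  \<open>\<beta>\<^sub>3\<close> maps to \<open>\<tau>\<^sub>1\<tau>\<^sub>3\<close>, of order 2. The exponents 36 and 18 are divisible by 3, and
  30 is even.\<close>

section \<open>Pure braids as a kernel\<close>

lemma group_hom_braid_perm: "group_hom (braid_group n) (sym_group_lr n) (braid_perm n)"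
  using group_braid_group group_sym_group_lr braid_perm_hom
  by (simp add: group_hom_def group_hom_axioms_def)

lemma pure_braid_one: "pure_braid n \<one>\<^bsub>braid_group n\<^esub>"
proof -
  interpret group_hom "braid_group n" "sym_group_lr n" "braid_perm n"
    by (rule group_hom_braid_perm)
  show ?thesis by (simp add: pure_braid_def)
qed

lemma pure_braid_mult:
  assumes "pure_braid n a" "pure_braid n b"
  shows "pure_braid n (a \<otimes>\<^bsub>braid_group n\<^esub> b)"
proof -
  interpret group_hom "braid_group n" "sym_group_lr n" "braid_perm n"
    by (rule group_hom_braid_perm)
  show ?thesis using assms by (simp add: pure_braid_def)
qed

lemma pure_braid_pow:
  assumes b: "b \<in> carrier (braid_group n)"
    and k: "braid_perm n b [^]\<^bsub>sym_group_lr n\<^esub> k = \<one>\<^bsub>sym_group_lr n\<^esub>" and "k dvd l"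
  shows "pure_braid n (b [^]\<^bsub>braid_group n\<^esub> (l :: nat))"
proof -
  interpret group_hom "braid_group n" "sym_group_lr n" "braid_perm n"
    by (rule group_hom_braid_perm)
  obtain j where "l = k * j"
    using \<open>k dvd l\<close> by blast
  then have "braid_perm n (b [^]\<^bsub>braid_group n\<^esub> l) =
      (braid_perm n b [^]\<^bsub>sym_group_lr n\<^esub> k) [^]\<^bsub>sym_group_lr n\<^esub> j"
    using b by (simp add: hom_nat_pow H.nat_pow_pow)
  then show ?thesis
    using b k by (simp add: pure_braid_def)
qed


section \<open>Purity of juxtapositions\<close>

lemma braid_hom_ext:
  assumes "group_hom (braid_group n) G f" "group_hom (braid_group n) G g"
    and gen: "\<And>i. i \<in> {1..<n} \<Longrightarrow> f (braid_gen n i) = g (braid_gen n i)"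
    and "b \<in> carrier (braid_group n)"
  shows "f b = g b"
proof -
  interpret f: group_hom "braid_group n" G f by fact
  interpret g: group_hom "braid_group n" G g by fact
  have "f (braid_class n w) = g (braid_class n w)" if "w \<in> braid_words n" for w
    using that
  proof (induction w)
    case Nil
    show ?case
      using f.hom_one g.hom_one by (simp add: one_braid_group)
  next
    case (Cons x w)
    obtain i e where x: "x = (i, e)" by (cases x)
    have i: "i \<in> {1..<n}" and w: "w \<in> braid_words n"
      using Cons.prems by (auto simp: x braid_words_def)
    have letter: "[(i, d)] \<in> braid_words n" for d
      using i by (simp add: braid_words_def)
    have cl: "braid_class n v \<in> carrier (braid_group n)" if "v \<in> braid_words n" for v
      using that by (simp add: carrier_braid_group)
    have "[(i, False), (i, True)] \<in> braid_words n"
      using i by (simp add: braid_words_def)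
    moreover have "braid_eq n [(i, False), (i, True)] []"
      using braid_eq.cancel[OF i, of False] by simp
    ultimately have "braid_class n [(i, False)] \<otimes>\<^bsub>braid_group n\<^esub> braid_gen n i =
        \<one>\<^bsub>braid_group n\<^esub>"
      using letter
      by (simp add: braid_gen_def mult_braid_group one_braid_group braid_class_eq_iff)
    then have "inv\<^bsub>braid_group n\<^esub> (braid_gen n i) = braid_class n [(i, False)]"
      using braid_gen_closed[OF i] cl[OF letter] by (rule f.G.inv_equality)
    then have "f (braid_class n [(i, False)]) = g (braid_class n [(i, False)])"
      using gen[OF i] f.hom_inv[OF braid_gen_closed[OF i]] g.hom_inv[OF braid_gen_closed[OF i]]
      by simp
    then have "f (braid_class n [x]) = g (braid_class n [x])"
      using gen[OF i] by (cases e) (simp_all add: x braid_gen_def)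
    moreover have "braid_class n (x # w) =
        braid_class n [x] \<otimes>\<^bsub>braid_group n\<^esub> braid_class n w"
      using mult_braid_group[OF letter w] by (simp add: x)
    ultimately show ?case
      using Cons.IH[OF w] cl[OF w] cl[OF letter] by (simp add: x)
  qed
  moreover obtain w where "w \<in> braid_words n" "b = braid_class n w"
    using assms(4) unfolding carrier_braid_group by blast
  ultimately show ?thesis by simp
qed

text \<open>Relabelling the points \<open>1, \<dots>, n\<close> as \<open>m + 1, \<dots>, m + n\<close> is the counterpart, on
  permutations, of moving a braid \<open>m\<close> strands to the right.\<close>

lemma map_permutation_hom:
  assumes "m + n \<le> N"
  shows "map_permutation {1..n} ((+) m) \<in> hom (sym_group_lr n) (sym_group_lr N)"
proof (rule homI)
  fix p assume "p \<in> carrier (sym_group_lr n)"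
  then have p: "p permutes {1..n}"
    by (simp add: sym_group_lr_def)
  have "map_permutation {1..n} ((+) m) p permutes ((+) m ` {1..n})"
    by (rule map_permutation_permutes[OF _ p]) (simp add: bij_betw_def)
  then have "map_permutation {1..n} ((+) m) p permutes {1..N}"
    by (rule permutes_subset) (use assms in auto)
  then show "map_permutation {1..n} ((+) m) p \<in> carrier (sym_group_lr N)"
    by (simp add: sym_group_lr_def)
next
  fix p q assume "p \<in> carrier (sym_group_lr n)" "q \<in> carrier (sym_group_lr n)"
  then have "p permutes {1..n}" "q permutes {1..n}"
    by (simp_all add: sym_group_lr_def)
  then show "map_permutation {1..n} ((+) m) (p \<otimes>\<^bsub>sym_group_lr n\<^esub> q) =
      map_permutation {1..n} ((+) m) p \<otimes>\<^bsub>sym_group_lr N\<^esub> map_permutation {1..n} ((+) m) q"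
    by (simp add: sym_group_lr_def map_permutation_compose')
qed

text \<open>Both sides are homomorphisms in \<open>b\<close>, so it suffices that they agree on generators.\<close>

lemma braid_perm_braid_embed:
  assumes le: "m + n \<le> N" and b: "b \<in> carrier (braid_group n)"
  shows "braid_perm N (braid_embed N m b) = map_permutation {1..n} ((+) m) (braid_perm n b)"
proof -
  have "group_hom (braid_group n) (sym_group_lr N) (braid_perm N \<circ> braid_embed N m)"
    using group_braid_group group_sym_group_lr hom_compose[OF braid_embed_hom[OF le] braid_perm_hom]
    by (intro group_hom.intro group_hom_axioms.intro)
  moreover have "group_hom (braid_group n) (sym_group_lr N)
      (map_permutation {1..n} ((+) m) \<circ> braid_perm n)"
    using group_braid_group group_sym_group_lr hom_compose[OF braid_perm_hom map_permutation_hom[OF le]]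
    by (intro group_hom.intro group_hom_axioms.intro)
  moreover have "(braid_perm N \<circ> braid_embed N m) (braid_gen n i) =
      (map_permutation {1..n} ((+) m) \<circ> braid_perm n) (braid_gen n i)"
    if i: "i \<in> {1..<n}" for i
    using i le by (simp add: braid_embed_gen[OF le i] braid_perm_gen map_permutation_transpose)
  ultimately have "(braid_perm N \<circ> braid_embed N m) b =
      (map_permutation {1..n} ((+) m) \<circ> braid_perm n) b"
    using b by (rule braid_hom_ext)
  then show ?thesis by simp
qed

lemma pure_braid_embed:
  assumes le: "m + n \<le> N" and "pure_braid n b"
  shows "pure_braid N (braid_embed N m b)"
proof -
  have b: "b \<in> carrier (braid_group n)" "braid_perm n b = id"
    using assms(2) by (simp_all add: pure_braid_def sym_group_lr_def)
  have "braid_embed N m b \<in> carrier (braid_group N)"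
    using braid_embed_hom[OF le] b(1) by (rule hom_in_carrier)
  moreover have "braid_perm N (braid_embed N m b) = id"
    by (simp add: braid_perm_braid_embed[OF le b(1)] b(2) map_permutation_id')
  ultimately show ?thesis
    by (simp add: pure_braid_def sym_group_lr_def)
qed

lemma pure_juxtapose:
  assumes "\<And>n b. (n, b) \<in> set bs \<Longrightarrow> pure_braid n b"
  shows "pure_braid (sum_list (map fst bs)) (juxtapose bs)"
proof -
  define N where "N = sum_list (map fst bs)"
  define m where "m k = sum_list (map fst (take k bs))" for k
  have factor: "pure_braid N (braid_embed N (m k) (snd (bs ! k)))" if k: "k < length bs" for k
  proof (rule pure_braid_embed)
    show "pure_braid (fst (bs ! k)) (snd (bs ! k))"
      using k by (intro assms) simp
    have "bs = take k bs @ bs ! k # drop (Suc k) bs"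
      using k by (rule id_take_nth_drop)
    then have "N = m k + (fst (bs ! k) + sum_list (map fst (drop (Suc k) bs)))"
      unfolding N_def m_def by (metis list.simps(9) map_append sum_list.Cons sum_list_append)
    then show "m k + fst (bs ! k) \<le> N" by simp
  qed
  have "pure_braid N (foldr (\<lambda>k x. braid_embed N (m k) (snd (bs ! k)) \<otimes>\<^bsub>braid_group N\<^esub> x)
      ks \<one>\<^bsub>braid_group N\<^esub>)" if "set ks \<subseteq> {..<length bs}" for ks
    using that by (induction ks) (simp_all add: pure_braid_one pure_braid_mult factor)
  from this[of "[0..<length bs]"] show ?thesis
    by (simp add: juxtapose_def Let_def N_def m_def atLeast0LessThan)
qed


section \<open>The permutations of the three blocks\<close>

lemma (in group) involution_int_pow:
  assumes x: "x \<in> carrier G" and "x \<otimes> x = \<one>"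
  shows "x [^] (k :: int) = (if even k then \<one> else x)"
proof -
  have sq: "x [^] (2 :: int) = \<one>"
    using assms int_pow_mult[OF x, of 1 1] by simp
  have ev: "x [^] (2 * j) = \<one>" for j :: int
    using int_pow_pow[OF x, of 2 j] by (simp add: sq)
  show ?thesis
  proof (cases "even k")
    case True
    then show ?thesis using ev by auto
  next
    case False
    then obtain j where "k = 2 * j + 1" by (rule oddE)
    then show ?thesis using ev[of j] x int_pow_mult[OF x, of "2 * j" 1] by simp
  qed
qed

lemma braid_perm_gen_int_pow:
  assumes i: "i \<in> {1..<n}"
  shows "braid_perm n (braid_gen n i [^]\<^bsub>braid_group n\<^esub> (k :: int)) =
    (if even k then id else transpose i (i + 1))"
proof -
  interpret group_hom "braid_group n" "sym_group_lr n" "braid_perm n"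
    by (rule group_hom_braid_perm)
  have "transpose i (i + 1) \<in> carrier (sym_group_lr n)"
    using hom_closed[OF braid_gen_closed[OF i]] by (simp add: braid_perm_gen[OF i])
  moreover have "transpose i (i + 1) \<otimes>\<^bsub>sym_group_lr n\<^esub> transpose i (i + 1) =
      \<one>\<^bsub>sym_group_lr n\<^esub>"
    by (simp add: sym_group_lr_def)
  ultimately have "transpose i (i + 1) [^]\<^bsub>sym_group_lr n\<^esub> k =
      (if even k then \<one>\<^bsub>sym_group_lr n\<^esub> else transpose i (i + 1))"
    by (rule H.involution_int_pow)
  moreover have "\<one>\<^bsub>sym_group_lr n\<^esub> = id"
    by (simp add: sym_group_lr_def)
  ultimately show ?thesis
    by (simp add: hom_int_pow[OF braid_gen_closed[OF i]] braid_perm_gen[OF i])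
qed

lemma braid_perm_inv_gen:
  assumes i: "i \<in> {1..<n}"
  shows "braid_perm n (inv\<^bsub>braid_group n\<^esub> (braid_gen n i)) = transpose i (i + 1)"
proof -
  interpret group "braid_group n" by (rule group_braid_group)
  show ?thesis
    using braid_perm_gen_int_pow[OF i, of "-1"] braid_gen_closed[OF i] by (simp add: int_pow_neg)
qed

lemma sym_group_lr_pow: "p [^]\<^bsub>sym_group_lr n\<^esub> (k :: nat) = p ^^ k"
  by (induction k) (simp_all add: sym_group_lr_def nat_pow_def funpow_swap1 fun_eq_iff)

lemma funpow_2: "p ^^ 2 = p \<circ> p"
  by (simp add: numeral_2_eq_2)

lemma funpow_3: "p ^^ 3 = p \<circ> p \<circ> p"
  by (simp add: numeral_3_eq_3 comp_assoc)

lemma pure_beta1_pow: "pure_braid 3 (beta1 [^]\<^bsub>braid_group 3\<^esub> (36 :: nat))"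
proof (rule pure_braid_pow)
  interpret group_hom "braid_group 3" "sym_group_lr 3" "braid_perm 3"
    by (rule group_hom_braid_perm)
  show "beta1 \<in> carrier (braid_group 3)"
    by (simp add: beta1_def braid_gen_closed)
  have "braid_perm 3 beta1 = transpose 2 3 \<circ> transpose 1 2"
    unfolding beta1_def
    by (simp add: braid_gen_closed braid_perm_gen braid_perm_inv_gen del: hom_inv)
      (simp add: sym_group_lr_def numeral_2_eq_2)
  then show "braid_perm 3 beta1 [^]\<^bsub>sym_group_lr 3\<^esub> (3 :: nat) = \<one>\<^bsub>sym_group_lr 3\<^esub>"
    unfolding sym_group_lr_pow funpow_3
    by (simp add: sym_group_lr_def fun_eq_iff transpose_def)
qed simp

text \<open>Here \<open>p\<close> is the permutation of \<open>\<beta>\<^sub>2\<close>, with cycles \<open>1 \<mapsto> 3 \<mapsto> 2 \<mapsto> 1\<close> and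
  \<open>4 \<mapsto> 5 \<mapsto> 6 \<mapsto> 4\<close>. Tabulating it first keeps the cube from turning into a
  case distinction through twelve nested transpositions.\<close>

lemma braid_perm_beta2_cube:
  fixes p :: "nat \<Rightarrow> nat"
  defines "p \<equiv> transpose 4 5 \<circ> (transpose 2 3 \<circ> (transpose 5 6 \<circ> transpose 1 2))"
  shows "p \<circ> p \<circ> p = id"
proof -
  have v: "p 1 = 3" "p 3 = 2" "p 2 = 1" "p 4 = 5" "p 5 = 6" "p 6 = 4"
    by (simp_all add: p_def transpose_def)
  have out: "p x = x" if "x \<notin> {1, 2, 3, 4, 5, 6}" for x
    using that by (simp add: p_def transpose_def)
  have "p (p (p x)) = x" for x
  proof (cases "x \<in> {1, 2, 3, 4, 5, 6}")
    case True
    then show ?thesis by (elim insertE emptyE) (simp_all only: v)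
  next
    case False
    then show ?thesis using out[of x] by simp
  qed
  then show ?thesis by (simp add: fun_eq_iff)
qed

lemma pure_beta2_pow: "pure_braid 6 (beta2 [^]\<^bsub>braid_group 6\<^esub> (18 :: nat))"
proof (rule pure_braid_pow)
  interpret group_hom "braid_group 6" "sym_group_lr 6" "braid_perm 6"
    by (rule group_hom_braid_perm)
  show "beta2 \<in> carrier (braid_group 6)"
    by (simp add: beta2_def braid_gen_closed)
  have "braid_perm 6 beta2 =
      transpose 4 5 \<circ> (transpose 2 3 \<circ> (transpose 5 6 \<circ> transpose 1 2))"
    unfolding beta2_def
    by (simp add: braid_gen_closed braid_perm_gen braid_perm_gen_int_pow)
      (simp add: sym_group_lr_def numeral_2_eq_2)
  then show "braid_perm 6 beta2 [^]\<^bsub>sym_group_lr 6\<^esub> (3 :: nat) = \<one>\<^bsub>sym_group_lr 6\<^esub>"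
    unfolding sym_group_lr_pow funpow_3
    by (simp only: braid_perm_beta2_cube sym_group_lr_def monoid.simps)
qed simp

lemma pure_beta3_pow: "pure_braid 4 (beta3 [^]\<^bsub>braid_group 4\<^esub> (30 :: nat))"
proof (rule pure_braid_pow)
  interpret group_hom "braid_group 4" "sym_group_lr 4" "braid_perm 4"
    by (rule group_hom_braid_perm)
  show "beta3 \<in> carrier (braid_group 4)"
    by (simp add: beta3_def braid_gen_closed)
  have "braid_perm 4 beta3 = transpose 3 4 \<circ> transpose 1 2"
    unfolding beta3_def
    by (simp add: braid_gen_closed braid_perm_gen braid_perm_gen_int_pow braid_perm_inv_gen
          del: hom_inv)
      (simp add: sym_group_lr_def numeral_2_eq_2)
  then show "braid_perm 4 beta3 [^]\<^bsub>sym_group_lr 4\<^esub> (2 :: nat) = \<one>\<^bsub>sym_group_lr 4\<^esub>"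
    unfolding sym_group_lr_pow funpow_2
    by (simp add: sym_group_lr_def fun_eq_iff transpose_def)
qed simp

theorem mainTheorem1: "pure_braid 36 beta"
proof -
  let ?bs = "[(3, beta1 [^]\<^bsub>braid_group 3\<^esub> (36 :: nat)),
     (6, beta2 [^]\<^bsub>braid_group 6\<^esub> (18 :: nat)),
     (3, beta1 [^]\<^bsub>braid_group 3\<^esub> (36 :: nat)),
     (4, beta3 [^]\<^bsub>braid_group 4\<^esub> (30 :: nat)),
     (4, beta3 [^]\<^bsub>braid_group 4\<^esub> (30 :: nat)),
     (4, beta3 [^]\<^bsub>braid_group 4\<^esub> (30 :: nat)),
     (3, beta1 [^]\<^bsub>braid_group 3\<^esub> (36 :: nat)),
     (6, beta2 [^]\<^bsub>braid_group 6\<^esub> (18 :: nat)),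
     (3, beta1 [^]\<^bsub>braid_group 3\<^esub> (36 :: nat))]"
  have "pure_braid (sum_list (map fst ?bs)) (juxtapose ?bs)"
    by (rule pure_juxtapose) (auto simp: pure_beta1_pow pure_beta2_pow pure_beta3_pow)
  then show ?thesis by (simp add: beta_def)
qed

end
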